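(* Let $m,n\ge 1$, let $U=\{u_1,\dots,u_m\}$ be a set of Boolean variables and $C=\{c_1,\dots,c_n\}$ a collection of $3$-literal clauses over $U$. Let $v\in\mathbb{R}^{6mn}$ be the objective vector associated with this instance: $v^{k,1}_{i,j}=1$ if clause $c_j$ has the literal $u_i$ at place $k$; $v^{k,2}_{i,j}=1$ if clause $c_j$ has the literal $\overline{u}_i$ at place $k$; and all remaining coordinates of $v$ equal $0$. Let $f_v(x)=\langle v,x\rangle$. Then the maximum of $f_v(x)$ over $SATP(m,n)$ equals the largest number of clauses of $C$ that can be simultaneously satisfied by a truth assignment to $U$ (the MAX-3SAT optimum).
   Context: For positive integers $m,n$, points of $\mathbb{R}^{6mn}$ have coordinates $x^{k,l}_{i,j}$ with $k\in\{1,2,3\}$, $l\in\{1,2\}$, $i\in\{1,\dots,m\}$, $j\in\{1,\dots,n\}$. $SATP(m,n)$ is the convex hull of all integral solutions of the system $$\sum_{k,l}x^{k,l}_{i,j}=1,\qquad x^{1,1}_{i,j}+x^{2,1}_{i,j}+x^{3,1}_{i,j}=x^{1,1}_{i,t}+x^{2,1}_{i,t}+x^{3,1}_{i,t},\qquad x^{k,1}_{i,j}+x^{k,2}_{i,j}=x^{k,1}_{s,j}+x^{k,2}_{s,j},\qquad x^{k,l}_{i,j}\ge 0,$$ for all $k\in\{1,2,3\}$, $l\in\{1,2\}$, $i,s\in\{1,\dots,m\}$, $j,t\in\{1,\dots,n\}$. A 3-literal clause is a disjunction of three literals occupying places $1,2,3$, each literal being a variable $u_i$ or its negation $\overline{u}_i$.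 A clause is satisfied by a truth assignment if at least one of its literals is true. *)

theory Defs
  imports "HOL-Analysis.Analysis"
begin

text \<open>
  The index ranges \<open>{1,2,3}\<close>, \<open>{1,2}\<close>, \<open>{1..m}\<close>, \<open>{1..n}\<close> are the types \<^typ>\<open>3\<close>, \<^typ>\<open>2\<close>,
  \<open>'m\<close> and \<open>'n\<close>, so \<open>m = CARD('m)\<close>, \<open>n = CARD('n)\<close>, and \<open>x $ (k, l, i, j)\<close> is the coordinate with
  upper indices \<open>k, l\<close> and lower indices \<open>i, j\<close>. The numerals \<open>1, 2, 3 :: 3\<close> enumerate the type \<^typ>\<open>3\<close>
  (with \<open>3 = 0\<close>), and \<open>1, 2 :: 2\<close> enumerate the type \<^typ>\<open>2\<close> (with \<open>2 = 0\<close>).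
\<close>

type_synonym ('m, 'n) satp_space = "real ^ (3 \<times> 2 \<times> 'm \<times> 'n)"

definition satp_feasible :: "('m::finite, 'n::finite) satp_space set" where
  "satp_feasible = {x.
     (\<forall>i j. (\<Sum>k\<in>UNIV. \<Sum>l\<in>UNIV. x $ (k, l, i, j)) = 1) \<and>
     (\<forall>i j t. x $ (1, 1, i, j) + x $ (2, 1, i, j) + x $ (3, 1, i, j)
            = x $ (1, 1, i, t) + x $ (2, 1, i, t) + x $ (3, 1, i, t)) \<and>
     (\<forall>k i s j. x $ (k, 1, i, j) + x $ (k, 2, i, j) = x $ (k, 1, s, j) + x $ (k, 2, s, j)) \<and>
     (\<forall>k l i j. x $ (k, l, i, j) \<ge> 0)}"

definition SATP :: "('m::finite, 'n::finite) satp_space set" where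
  "SATP = convex hull {x \<in> satp_feasible. \<forall>k l i j. x $ (k, l, i, j) \<in> \<int>}"

datatype 'u lit = Pos 'u | Neg 'u

type_synonym 'u clause3 = "3 \<Rightarrow> 'u lit"

fun lit_true :: "('u \<Rightarrow> bool) \<Rightarrow> 'u lit \<Rightarrow> bool" where
  "lit_true \<tau> (Pos u) \<longleftrightarrow> \<tau> u"
| "lit_true \<tau> (Neg u) \<longleftrightarrow> \<not> \<tau> u"

definition clause_satisfied :: "('u \<Rightarrow> bool) \<Rightarrow> 'u clause3 \<Rightarrow> bool" where
  "clause_satisfied \<tau> c \<longleftrightarrow> (\<exists>k. lit_true \<tau> (c k))"

text \<open>
  Instances are families \<open>c\<close> of clauses indexed by \<open>'n\<close>, with the variables indexed by \<open>'m\<close>;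
  repeated clauses are counted with multiplicity.
\<close>

definition max_3sat :: "('n::finite \<Rightarrow> 'm::finite clause3) \<Rightarrow> nat" where
  "max_3sat c = Max (range (\<lambda>\<tau> :: 'm \<Rightarrow> bool. card {j. clause_satisfied \<tau> (c j)}))"

definition objective_vector ::
    "('n::finite \<Rightarrow> 'm::finite clause3) \<Rightarrow> ('m, 'n) satp_space" where
  "objective_vector c = (\<chi> p. case p of (k, l, i, j) \<Rightarrow>
     if l = 1 \<and> c j k = Pos i \<or> l = 2 \<and> c j k = Neg i then 1 else 0)"

end

theory Submission
  imports Defs
begin

text \<open>
  In an integral solution exactly one entry of each \<open>3 \<times> 2\<close> block \<open>(i, j)\<close> is \<open>1\<close>; the second system
  of equations forces its index \<open>l\<close> to depend on \<open>i\<close> only, and the third its index \<open>k\<close> to depend on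
  \<open>j\<close> only. So integral solutions correspond to pairs of a truth assignment (\<open>l = 1\<close> meaning true)
  and a choice of one place in each clause, and the objective counts the clauses whose literal at the
  chosen place is true.
\<close>

definition satp_vertex :: "('n::finite \<Rightarrow> 3) \<Rightarrow> ('m::finite \<Rightarrow> bool) \<Rightarrow> ('m, 'n) satp_space" where
  "satp_vertex K \<tau> = (\<chi> p. case p of (k, l, i, j) \<Rightarrow>
     of_bool (k = K j \<and> l = (if \<tau> i then 1 else 2)))"

lemma satp_vertex_nth [simp]:
  "satp_vertex K \<tau> $ (k, l, i, j) = of_bool (k = K j \<and> l = (if \<tau> i then 1 else 2))"
  by (simp add: satp_vertex_def)

lemma satp_vertex_feasible: "satp_vertex K \<tau> \<in> satp_feasible"
proof -
  have K: "K j = 1 \<or> K j = 2 \<or> K j = 3" for j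
    by (rule exhaust_3)
  have "(\<Sum>k\<in>UNIV. \<Sum>l\<in>UNIV. satp_vertex K \<tau> $ (k, l, i, j)) = 1" for i j
    using K[of j] by (auto simp: sum_3 sum_2)
  \<comment> \<open>The value is free of \<open>j\<close>, and the next one is free of
    \<open>i\<close>; this is what the two families of equations demand.\<close>
  moreover have "satp_vertex K \<tau> $ (1, 1, i, j) + satp_vertex K \<tau> $ (2, 1, i, j)
      + satp_vertex K \<tau> $ (3, 1, i, j) = of_bool (\<tau> i)" for i j
    using K[of j] by auto
  moreover have "satp_vertex K \<tau> $ (k, 1, i, j) + satp_vertex K \<tau> $ (k, 2, i, j)
      = of_bool (k = K j)" for k i j
    by auto
  ultimately show ?thesis
    unfolding satp_feasible_def by simp
qed

lemma integral_feasible_imp_vertex: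
  fixes x :: "('m::finite, 'n::finite) satp_space"
  assumes feasible: "x \<in> satp_feasible" and integral: "\<And>k l i j. x $ (k, l, i, j) \<in> \<int>"
  obtains K \<tau> where "x = satp_vertex K \<tau>"
proof -
  define R where "R i j = x $ (1, 1, i, j) + x $ (2, 1, i, j) + x $ (3, 1, i, j)" for i j
  define C where "C k i j = x $ (k, 1, i, j) + x $ (k, 2, i, j)" for k i j
  have total: "C 1 i j + C 2 i j + C 3 i j = 1" for i j
    using feasible by (simp add: satp_feasible_def sum_3 sum_2 C_def)
  have R_const: "R i j = R i t" for i j t
    using feasible unfolding satp_feasible_def R_def by blast
  have C_const: "C k i j = C k s j" for k i s j
    using feasible unfolding satp_feasible_def C_def by blast
  have nonneg: "x $ (k, l, i, j) \<ge> 0" for k l i j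
    using feasible by (simp add: satp_feasible_def)
  \<comment> \<open>Integrality enters only through this gap between 0 and 1.\<close>
  have zero_or_ge1: "x $ (k, l, i, j) = 0 \<or> x $ (k, l, i, j) \<ge> 1" for k l i j
    using integral[of k l i j] nonneg[of k l i j] by (auto elim!: Ints_cases)
  \<comment> \<open>Here and in \<open>K\<close>, \<open>undefined\<close> is just some index: by
    \<open>R_const\<close> and \<open>C_const\<close> its choice does not matter.\<close>
  define \<tau> where "\<tau> i \<longleftrightarrow> R i undefined = 1" for i
  define K where "K j = (SOME k. C k undefined j = 1)" for j
  have \<tau>: "\<tau> i \<longleftrightarrow> R i j = 1" for i j
    unfolding \<tau>_def using R_const by metis
  have "\<exists>k. C k i j = 1" for i j
  proof -
    \<comment> \<open>Each of the three sums is 0 or at least 1, and they add up to 1.\<close>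
    have "C 1 i j = 1 \<or> C 2 i j = 1 \<or> C 3 i j = 1"
      using total[of i j] nonneg[of _ _ i j] zero_or_ge1[of 1 1 i j] zero_or_ge1[of 1 2 i j]
        zero_or_ge1[of 2 1 i j] zero_or_ge1[of 2 2 i j]
        zero_or_ge1[of 3 1 i j] zero_or_ge1[of 3 2 i j]
      unfolding C_def by (smt (verit))
    then show ?thesis by blast
  qed
  then have "C (K j) undefined j = 1" for j
    unfolding K_def by (rule someI_ex)
  then have K: "C (K j) i j = 1" for i j
    using C_const by metis
  have "x $ (k, l, i, j) = satp_vertex K \<tau> $ (k, l, i, j)" for k l i j
  proof -
    \<comment> \<open>Place \<open>K j\<close> already uses up the whole total 1, so nonnegativity
      kills every other entry of the block.\<close>
    have off: "x $ (k', l', i, j) = 0" if "k' \<noteq> K j" for k' l'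
    proof -
      have "C k' i j = 0"
        using that total[of i j] K[of j i] nonneg[of _ _ i j] exhaust_3[of "K j"] exhaust_3[of k']
        unfolding C_def by (smt (verit))
      then show ?thesis
        using nonneg[of k' _ i j] exhaust_2[of l'] unfolding C_def by (smt (verit))
    qed
    have "R i j = x $ (K j, 1, i, j)"
      using exhaust_3[of "K j"] off[of 1 1] off[of 2 1] off[of 3 1] unfolding R_def by auto
    moreover have "x $ (K j, 1, i, j) + x $ (K j, 2, i, j) = 1"
      using K[of j i] by (simp add: C_def)
    ultimately have "x $ (K j, 1, i, j) = of_bool (\<tau> i)" "x $ (K j, 2, i, j) = of_bool (\<not> \<tau> i)"
      using \<tau>[of i j] zero_or_ge1[of "K j" 1 i j] nonneg[of "K j" 2 i j] by auto
    then show ?thesis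
      using off exhaust_2[of l] by auto
  qed
  then have "x = satp_vertex K \<tau>"
    by (simp add: vec_eq_iff)
  then show thesis by (rule that)
qed

text \<open>Both vectors are 0/1-valued, so the inner product is the size of their common support
  \<open>S\<close>. Each clause contributes at most one coordinate to it, since place
  \<open>K j\<close> holds a single literal.\<close>

lemma objective_satp_vertex:
  fixes c :: "'n::finite \<Rightarrow> 'm::finite clause3"
  shows "objective_vector c \<bullet> satp_vertex K \<tau> = real (card {j. lit_true \<tau> (c j (K j))})"
proof -
  define S where "S = {(k, l :: 2, i, j). k = K j \<and> l = (if \<tau> i then 1 else 2) \<and>
      (l = 1 \<and> c j k = Pos i \<or> l = 2 \<and> c j k = Neg i)}"
  have "objective_vector c \<bullet> satp_vertex K \<tau> = (\<Sum>p\<in>UNIV. of_bool (p \<in> S))"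
    unfolding inner_vec_def objective_vector_def satp_vertex_def S_def
    by (intro sum.cong) (auto split: prod.splits)
  also have "\<dots> = real (card S)"
    by (simp add: of_bool_def sum.If_cases)
  also have "bij_betw (\<lambda>(k, l, i, j). j) S {j. lit_true \<tau> (c j (K j))}"
  proof (rule bij_betw_imageI)
    show "inj_on (\<lambda>(k, l, i, j). j) S"
      \<comment> \<open>The index \<open>j\<close> fixes \<open>k = K j\<close>, and the literal
        \<open>c j k\<close> then fixes \<open>i\<close> and \<open>l\<close>.\<close>
      by (auto simp: inj_on_def S_def split: if_splits)
    have "j \<in> (\<lambda>(k, l, i, j). j) ` S" if "lit_true \<tau> (c j (K j))" for j
    proof (cases "c j (K j)")
      case (Pos i)
      then show ?thesis
        using that by (intro image_eqI[of _ _ "(K j, 1, i, j)"]) (auto simp: S_def)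
    next
      case (Neg i)
      then show ?thesis
        using that by (intro image_eqI[of _ _ "(K j, 2, i, j)"]) (auto simp: S_def)
    qed
    then show "(\<lambda>(k, l, i, j). j) ` S = {j. lit_true \<tau> (c j (K j))}"
      by (auto simp: S_def split: if_splits)
  qed
  then have "card S = card {j. lit_true \<tau> (c j (K j))}"
    by (rule bij_betw_same_card)
  finally show ?thesis .
qed

theorem theorem11:
  fixes c :: "'n::finite \<Rightarrow> 'm::finite clause3"
  shows "(\<exists>x \<in> SATP. objective_vector c \<bullet> x = real (max_3sat c)) \<and>
         (\<forall>x \<in> SATP. objective_vector c \<bullet> x \<le> real (max_3sat c))"
proof
  have "max_3sat c \<in> range (\<lambda>\<tau> :: 'm \<Rightarrow> bool. card {j. clause_satisfied \<tau> (c j)})"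
    unfolding max_3sat_def by (rule Max_in) auto
  then obtain \<tau> where \<tau>: "max_3sat c = card {j. clause_satisfied \<tau> (c j)}"
    by blast
  \<comment> \<open>The place of some true literal if there is one; in an unsatisfied clause the
    choice is arbitrary and harmless, as every literal there is false.\<close>
  define K where "K j = (SOME k. lit_true \<tau> (c j k))" for j
  have "clause_satisfied \<tau> (c j) \<longleftrightarrow> lit_true \<tau> (c j (K j))" for j
    unfolding clause_satisfied_def K_def by (metis someI_ex)
  then have "objective_vector c \<bullet> satp_vertex K \<tau> = real (max_3sat c)"
    by (simp add: objective_satp_vertex \<tau>)
  moreover have "satp_vertex K \<tau> \<in> SATP"
    unfolding SATP_def by (rule hull_inc) (simp add: satp_vertex_feasible)
  ultimately show "\<exists>x \<in> SATP. objective_vector c \<bullet> x = real (max_3sat c)"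
    by blast
next
  have "objective_vector c \<bullet> satp_vertex K \<tau> \<le> real (max_3sat c)" for K \<tau>
  proof -
    \<comment> \<open>A true literal at the chosen place satisfies its clause, whatever
      \<open>K\<close> is.\<close>
    have "card {j. lit_true \<tau> (c j (K j))} \<le> card {j. clause_satisfied \<tau> (c j)}"
      by (rule card_mono) (auto simp: clause_satisfied_def)
    also have "\<dots> \<le> max_3sat c"
      unfolding max_3sat_def by (rule Max_ge) auto
    finally show ?thesis
      by (simp add: objective_satp_vertex)
  qed
  then have "{x \<in> satp_feasible. \<forall>k l i j. x $ (k, l, i, j) \<in> \<int>}
      \<subseteq> {x. objective_vector c \<bullet> x \<le> real (max_3sat c)}"
    using integral_feasible_imp_vertex by (smt (verit) mem_Collect_eq subsetI)
  \<comment> \<open>The objective is linear, so its upper bound describes a convex half-space, which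
    contains the hull once it contains the integral solutions.\<close>
  then have "SATP \<subseteq> {x. objective_vector c \<bullet> x \<le> real (max_3sat c)}"
    unfolding SATP_def by (rule hull_minimal) (rule convex_halfspace_le)
  then show "\<forall>x \<in> SATP. objective_vector c \<bullet> x \<le> real (max_3sat c)"
    by blast
qed

end
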